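(* Let $f_1,\dots,f_s$ be nonzero elements of $\mathbf F=\mathbb K[\![x_1,\dots,x_n]\!]$, let $\mathbf A=\mathbb K[\![f_1,\dots,f_s]\!]$ and let $a\in U^n$. For all $i\in\{1,\dots,s\}$, write $\mathrm M(f_i,a)=c_{\alpha_i}\underline x^{\alpha_i}$. Let $C=\{\sum_{i=1}^s\lambda_i\alpha_i\mid\lambda_i\in\mathbb R_+\}$ be the cone generated by $\{\alpha_1,\dots,\alpha_s\}$. If $\mathrm{Supp}(f_i)\subseteq C$ for all $i\in\{1,\dots,s\}$, then $\mathrm{exp}(\mathbf A,a)\subseteq C$. In particular, $\mathrm{exp}(\mathbf A,a)$ is finitely generated.
   Context: $\mathbb K$ is a field, $n\ge 1$, $\underline x=(x_1,\dots,x_n)$, $\mathbf F=\mathbb K[\![x_1,\dots,x_n]\!]$, $U=\mathbb R_{>0}$, $\mathbb R_+=[0,\infty)$. Fix a total well ordering $\prec$ on $\mathbb N^n$ compatible with sums. For $a\in U^n$ and a nonzero $f=\sum c_\alpha\underline x^\alpha\in\mathbf F$: $\mathrm{Supp}(f)=\{\alpha\mid c_\alpha\ne0\}$; $\nu(f,a)=\min\{a\cdot\alpha\mid\alpha\in\mathrm{Supp}(f)\}$; $\mathrm{in}(f,a)=\sum_{\alpha\in\mathrm{Supp}(f),\,a\cdot\alpha=\nu(f,a)}c_\alpha\underline x^\alpha$; $\mathrm{exp}(f,a)=\max_\prec\mathrm{Supp}(\mathrm{in}(f,a))$; $\mathrm M(f,a)=c_{\mathrm{exp}(f,a)}\underline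 x^{\mathrm{exp}(f,a)}$. For $S\subseteq\mathbf F$, $\mathbb K[\![S]\!]$ is the closure, in the $(x_1,\dots,x_n)$-adic topology, of the $\mathbb K$-subalgebra of $\mathbf F$ generated by $S$ (for a finite set of series without constant term it is the set of all formal power series in them). $\mathrm{exp}(\mathbf A,a)=\{\mathrm{exp}(f,a)\mid f\in\mathbf A\setminus\{0\}\}$, a subsemigroup of $\mathbb N^n$ containing $0$. *)

theory Defs
  imports "HOL-Analysis.Analysis"
begin

section \<open>Formal power series in finitely many variables\<close>

text \<open>The variables are indexed by a finite type \<open>'n\<close>, and an exponent is a vector in \<open>nat ^ 'n\<close>.\<close>

typedef ('a, 'n) mfps = "UNIV :: (nat ^ 'n::finite \<Rightarrow> 'a) set"
  morphisms coeff Abs_mfps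
  by simp

lemma coeff_Abs_mfps [simp]: "coeff (Abs_mfps h) = h"
  by (simp add: Abs_mfps_inverse)

lemma mfps_eqI: "(\<And>\<gamma>. coeff f \<gamma> = coeff g \<gamma>) \<Longrightarrow> f = g"
  by (metis coeff_inverse ext)

definition splittings :: "nat ^ 'n::finite \<Rightarrow> ((nat ^ 'n) \<times> (nat ^ 'n)) set" where
  "splittings \<gamma> = {(\<alpha>, \<beta>). \<alpha> + \<beta> = \<gamma>}"

lemma finite_vec_le: "finite {\<alpha> :: nat ^ 'n::finite. \<forall>i. \<alpha> $ i \<le> \<gamma> $ i}"
proof -
  have "{\<alpha> :: nat ^ 'n. \<forall>i. \<alpha> $ i \<le> \<gamma> $ i} \<subseteq> vec_lambda ` (\<Pi>\<^sub>E i\<in>UNIV. {..\<gamma> $ i})"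
  proof
    fix \<alpha> :: "nat ^ 'n"
    assume "\<alpha> \<in> {\<alpha>. \<forall>i. \<alpha> $ i \<le> \<gamma> $ i}"
    then have "vec_nth \<alpha> \<in> (\<Pi>\<^sub>E i\<in>UNIV. {..\<gamma> $ i})" by auto
    then have "vec_lambda (vec_nth \<alpha>) \<in> vec_lambda ` (\<Pi>\<^sub>E i\<in>UNIV. {..\<gamma> $ i})" by blast
    then show "\<alpha> \<in> vec_lambda ` (\<Pi>\<^sub>E i\<in>UNIV. {..\<gamma> $ i})" by simp
  qed
  then show ?thesis
    by (rule finite_subset) (intro finite_imageI finite_PiE, auto)
qed

lemma finite_splittings [simp]: "finite (splittings \<gamma>)"
proof -
  have "splittings \<gamma> \<subseteq> {\<alpha>. \<forall>i. \<alpha> $ i \<le> \<gamma> $ i} \<times> {\<alpha>. \<forall>i. \<alpha> $ i \<le> \<gamma> $ i}"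
    by (auto simp: splittings_def)
  then show ?thesis
    by (rule finite_subset) (intro finite_cartesian_product finite_vec_le)
qed

definition monom :: "'a::zero \<Rightarrow> nat ^ 'n::finite \<Rightarrow> ('a, 'n) mfps" where
  "monom c \<alpha> = Abs_mfps (\<lambda>\<beta>. if \<beta> = \<alpha> then c else 0)"

lemma splittings_0_left:
  fixes h :: "nat ^ 'n::finite \<Rightarrow> 'a::comm_ring_1"
  shows "(\<Sum>(\<alpha>, \<beta>)\<in>splittings \<gamma>. (if \<alpha> = 0 then 1 else 0) * h \<beta>) = h \<gamma>"
proof -
  have "(\<Sum>(\<alpha>, \<beta>)\<in>splittings \<gamma>. (if \<alpha> = 0 then 1 else 0) * h \<beta>)
      = (\<Sum>(\<alpha>, \<beta>)\<in>{(0 :: nat ^ 'n, \<gamma>)}. (if \<alpha> = 0 then 1 else 0) * h \<beta>)"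
    by (rule sum.mono_neutral_right[OF finite_splittings])
      (auto simp: splittings_def split: if_splits)
  then show ?thesis by simp
qed

lemma splittings_swap:
  "(\<Sum>(\<alpha>, \<beta>)\<in>splittings \<gamma>. h \<alpha> \<beta>) = (\<Sum>(\<alpha>, \<beta>)\<in>splittings \<gamma>. h \<beta> \<alpha>)"
  by (rule sum.reindex_bij_witness[where i = prod.swap and j = prod.swap])
    (auto simp: splittings_def add.commute)

lemma splittings_assoc:
  fixes u v w :: "nat ^ 'n::finite \<Rightarrow> 'a::comm_ring_1"
  shows "(\<Sum>(\<alpha>, \<beta>)\<in>splittings \<gamma>. (\<Sum>(\<alpha>1, \<alpha>2)\<in>splittings \<alpha>. u \<alpha>1 * v \<alpha>2) * w \<beta>)
       = (\<Sum>(\<alpha>, \<beta>)\<in>splittings \<gamma>. u \<alpha> * (\<Sum>(\<beta>1, \<beta>2)\<in>splittings \<beta>. v \<beta>1 * w \<beta>2))"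
proof -
  have "(\<Sum>(\<alpha>, \<beta>)\<in>splittings \<gamma>. (\<Sum>(\<alpha>1, \<alpha>2)\<in>splittings \<alpha>. u \<alpha>1 * v \<alpha>2) * w \<beta>)
      = (\<Sum>p\<in>splittings \<gamma>. \<Sum>q\<in>splittings (fst p). u (fst q) * v (snd q) * w (snd p))"
    by (simp add: case_prod_beta sum_distrib_right)
  also have "\<dots> = (\<Sum>(p, q)\<in>(SIGMA p:splittings \<gamma>. splittings (fst p)).
      u (fst q) * v (snd q) * w (snd p))"
    by (simp add: sum.Sigma)
  also have "\<dots> = (\<Sum>(p, q)\<in>(SIGMA p:splittings \<gamma>. splittings (snd p)).
      u (fst p) * (v (fst q) * w (snd q)))"
    by (rule sum.reindex_bij_witness[where
          j = "\<lambda>(p, q). ((fst q, snd q + snd p), (snd q, snd p))" and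
          i = "\<lambda>(p, q). ((fst p + fst q, snd q), (fst p, fst q))"])
      (auto simp: splittings_def add.assoc mult.assoc)
  also have "\<dots> = (\<Sum>p\<in>splittings \<gamma>. \<Sum>q\<in>splittings (snd p). u (fst p) * (v (fst q) * w (snd q)))"
    by (simp add: sum.Sigma)
  also have "\<dots> = (\<Sum>(\<alpha>, \<beta>)\<in>splittings \<gamma>. u \<alpha> * (\<Sum>(\<beta>1, \<beta>2)\<in>splittings \<beta>. v \<beta>1 * w \<beta>2))"
    by (simp add: case_prod_beta sum_distrib_left)
  finally show ?thesis .
qed

instantiation mfps :: (comm_ring_1, finite) comm_ring_1
begin

definition zero_mfps :: "('a, 'b) mfps" where "0 = Abs_mfps (\<lambda>_. 0)"
definition one_mfps :: "('a, 'b) mfps" where "1 = monom 1 0"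
definition plus_mfps :: "('a, 'b) mfps \<Rightarrow> ('a, 'b) mfps \<Rightarrow> ('a, 'b) mfps" where
  "f + g = Abs_mfps (\<lambda>\<gamma>. coeff f \<gamma> + coeff g \<gamma>)"
definition minus_mfps :: "('a, 'b) mfps \<Rightarrow> ('a, 'b) mfps \<Rightarrow> ('a, 'b) mfps" where
  "f - g = Abs_mfps (\<lambda>\<gamma>. coeff f \<gamma> - coeff g \<gamma>)"
definition uminus_mfps :: "('a, 'b) mfps \<Rightarrow> ('a, 'b) mfps" where
  "- f = Abs_mfps (\<lambda>\<gamma>. - coeff f \<gamma>)"
definition times_mfps :: "('a, 'b) mfps \<Rightarrow> ('a, 'b) mfps \<Rightarrow> ('a, 'b) mfps" where
  "f * g = Abs_mfps (\<lambda>\<gamma>. \<Sum>(\<alpha>, \<beta>)\<in>splittings \<gamma>. coeff f \<alpha> * coeff g \<beta>)"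

instance
proof
  fix f g h :: "('a, 'b) mfps"
  show "f * g * h = f * (g * h)"
    by (rule mfps_eqI) (simp add: times_mfps_def splittings_assoc)
  show "f * g = g * f"
    by (rule mfps_eqI)
      (simp add: times_mfps_def,
        subst splittings_swap, simp add: mult.commute)
  show "1 * f = f"
    by (rule mfps_eqI) (simp add: times_mfps_def one_mfps_def monom_def splittings_0_left)
  show "(f + g) * h = f * h + g * h"
    by (rule mfps_eqI)
      (simp add: times_mfps_def plus_mfps_def case_prod_beta distrib_right sum.distrib)
  show "(0::('a, 'b) mfps) \<noteq> 1"
  proof
    assume "(0::('a, 'b) mfps) = 1"
    then have "coeff (0::('a, 'b) mfps) 0 = coeff 1 0" by simp
    then show False by (simp add: zero_mfps_def one_mfps_def monom_def)
  qed
qed (auto intro!: mfps_eqI simp: plus_mfps_def zero_mfps_def minus_mfps_def uminus_mfps_def)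

end

section \<open>The adic topology and closed subalgebras\<close>

text \<open>In a commutative ring, \<open>module.span (*) S\<close> is the ideal generated by \<open>S\<close>.\<close>

lemma module_mfps: "module ((*) :: ('a::comm_ring_1, 'n::finite) mfps \<Rightarrow> _)"
  by unfold_locales (simp_all add: algebra_simps)

definition var :: "'n::finite \<Rightarrow> ('a::comm_ring_1, 'n) mfps" where
  "var i = monom 1 (axis i 1)"

definition var_ideal :: "('a::comm_ring_1, 'n::finite) mfps set" where
  "var_ideal = module.span (*) (range var)"

primrec var_ideal_pow :: "nat \<Rightarrow> ('a::comm_ring_1, 'n::finite) mfps set" where
  "var_ideal_pow 0 = UNIV"
| "var_ideal_pow (Suc N) =
     module.span (*) {f * g | f g. f \<in> var_ideal \<and> g \<in> var_ideal_pow N}"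

lemma subspace_var_ideal_pow:
  "module.subspace (*) (var_ideal_pow N :: ('a::comm_ring_1, 'n::finite) mfps set)"
  by (cases N) (simp_all add: module.subspace_UNIV[OF module_mfps]
      module.subspace_span[OF module_mfps])

lemma var_ideal_pow_Suc_subset:
  "var_ideal_pow (Suc N) \<subseteq> (var_ideal_pow N :: ('a::comm_ring_1, 'n::finite) mfps set)"
  unfolding var_ideal_pow.simps
  by (rule module.span_minimal[OF module_mfps _ subspace_var_ideal_pow])
    (auto intro: module.subspace_scale[OF module_mfps subspace_var_ideal_pow])

lemma var_ideal_pow_antimono:
  "M \<le> N \<Longrightarrow> var_ideal_pow N \<subseteq> (var_ideal_pow M :: ('a::comm_ring_1, 'n::finite) mfps set)"
  by (rule lift_Suc_antimono_le[of var_ideal_pow]) (rule var_ideal_pow_Suc_subset)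

instantiation mfps :: (comm_ring_1, finite) topological_space
begin

definition open_mfps :: "('a, 'b) mfps set \<Rightarrow> bool" where
  "open U \<longleftrightarrow> (\<forall>f\<in>U. \<exists>N. {f + h | h. h \<in> var_ideal_pow N} \<subseteq> U)"

instance
proof
  show "open (UNIV :: ('a, 'b) mfps set)" by (simp add: open_mfps_def)
next
  fix U V :: "('a, 'b) mfps set"
  assume U: "open U" and V: "open V"
  show "open (U \<inter> V)"
    unfolding open_mfps_def
  proof
    fix f assume "f \<in> U \<inter> V"
    then obtain M N where M: "{f + h | h. h \<in> var_ideal_pow M} \<subseteq> U"
      and N: "{f + h | h. h \<in> var_ideal_pow N} \<subseteq> V"
      using U V unfolding open_mfps_def by blast
    have "var_ideal_pow (max M N) \<subseteq> (var_ideal_pow M :: ('a, 'b) mfps set)"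
      "var_ideal_pow (max M N) \<subseteq> (var_ideal_pow N :: ('a, 'b) mfps set)"
      by (simp_all add: var_ideal_pow_antimono)
    with M N have "{f + h | h. h \<in> var_ideal_pow (max M N)} \<subseteq> U \<inter> V" by blast
    then show "\<exists>K. {f + h | h. h \<in> var_ideal_pow K} \<subseteq> U \<inter> V" by blast
  qed
next
  fix \<U> :: "('a, 'b) mfps set set"
  assume "\<forall>U\<in>\<U>. open U"
  then show "open (\<Union>\<U>)" unfolding open_mfps_def by (meson Union_iff Sup_upper subset_trans)
qed

end

text \<open>Subalgebras are unital, since they contain the constant series.\<close>

definition subalgebra :: "('a::comm_ring_1, 'n::finite) mfps set \<Rightarrow> bool" where
  "subalgebra B \<longleftrightarrow> (\<forall>c. monom c 0 \<in> B) \<and> (\<forall>f\<in>B. \<forall>g\<in>B. f + g \<in> B \<and> f * g \<in> B)"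

definition closed_algebra_gen ::
  "('a::comm_ring_1, 'n::finite) mfps set \<Rightarrow> ('a, 'n) mfps set" where
  "closed_algebra_gen S = closure (subalgebra hull S)"

section \<open>Weighted initial forms and exponents\<close>

definition real_vec :: "nat ^ 'n::finite \<Rightarrow> real ^ 'n" where
  "real_vec \<alpha> = (\<chi> i. real (\<alpha> $ i))"

text \<open>The relation is reflexive: \<open>(\<alpha>, \<beta>) \<in> r\<close> stands for \<open>\<alpha> \<preceq> \<beta>\<close>.\<close>

definition monomial_order :: "(nat ^ 'n::finite) rel \<Rightarrow> bool" where
  "monomial_order r \<longleftrightarrow>
     well_order_on UNIV r \<and> (\<forall>\<alpha> \<beta> \<gamma>. (\<alpha>, \<beta>) \<in> r \<longrightarrow> (\<alpha> + \<gamma>, \<beta> + \<gamma>) \<in> r)"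

definition Supp :: "('a::zero, 'n::finite) mfps \<Rightarrow> (nat ^ 'n) set" where
  "Supp f = {\<alpha>. coeff f \<alpha> \<noteq> 0}"

text \<open>For a positive weight \<open>a\<close> and \<open>f \<noteq> 0\<close>, the minimum defining \<open>val\<close> is attained and the
  support of \<open>initial_form f a\<close> is finite and nonempty, so the maximum in \<open>expo\<close> exists.
  For \<open>f = 0\<close> these quantities are unspecified.\<close>

definition val :: "('a::zero, 'n::finite) mfps \<Rightarrow> real ^ 'n \<Rightarrow> real" where
  "val f a = (LEAST v. \<exists>\<alpha>\<in>Supp f. v = a \<bullet> real_vec \<alpha>)"

definition initial_form :: "('a::zero, 'n::finite) mfps \<Rightarrow> real ^ 'n \<Rightarrow> ('a, 'n) mfps" where
  "initial_form f a = Abs_mfps (\<lambda>\<alpha>. if a \<bullet> real_vec \<alpha> = val f a then coeff f \<alpha> else 0)"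

definition expo ::
  "(nat ^ 'n::finite) rel \<Rightarrow> ('a::zero, 'n) mfps \<Rightarrow> real ^ 'n \<Rightarrow> nat ^ 'n" where
  "expo r f a = (THE \<alpha>. \<alpha> \<in> Supp (initial_form f a) \<and>
                        (\<forall>\<beta>\<in>Supp (initial_form f a). (\<beta>, \<alpha>) \<in> r))"

definition lead_monom ::
  "(nat ^ 'n::finite) rel \<Rightarrow> ('a::zero, 'n) mfps \<Rightarrow> real ^ 'n \<Rightarrow> ('a, 'n) mfps" where
  "lead_monom r f a = monom (coeff f (expo r f a)) (expo r f a)"

definition expo_set ::
  "(nat ^ 'n::finite) rel \<Rightarrow> ('a::comm_ring_1, 'n) mfps set \<Rightarrow> real ^ 'n \<Rightarrow> (nat ^ 'n) set" where
  "expo_set r A a = {expo r f a | f. f \<in> A - {0}}"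

section \<open>Finitely generated semigroups with zero\<close>

definition submonoid :: "'b::comm_monoid_add set \<Rightarrow> bool" where
  "submonoid H \<longleftrightarrow> 0 \<in> H \<and> (\<forall>\<alpha>\<in>H. \<forall>\<beta>\<in>H. \<alpha> + \<beta> \<in> H)"

definition finitely_generated :: "'b::comm_monoid_add set \<Rightarrow> bool" where
  "finitely_generated H \<longleftrightarrow> (\<exists>G. finite G \<and> H = submonoid hull G)"

end

theory Submission
  imports Defs
begin

text \<open>
  Each exponent of an element \<open>g\<close> of the algebra lies in the support of \<open>g\<close>, so the inclusion in
  the cone \<open>C\<close> is really a statement about supports. The series supported in a submonoid of
  \<open>\<nat>\<^sup>n\<close> form a subalgebra, because exponents add in a product, and this subalgebra is closed,
  because a single coefficient is unchanged by a perturbation in a high power of the ideal of the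
  variables. The lattice points of \<open>C\<close> are such a submonoid, and the generators are supported in
  it; hence so is every element of the closed algebra (\<open>Supp_closed_algebra_gen\<close>).

  Finite generation is then a matter of semigroups. The set \<open>E\<close> of exponents is a submonoid,
  since the closure of a subalgebra is again closed under products and the exponent of a product is
  the sum of the exponents. It contains the \<open>\<alpha>\<^sub>i\<close> and lies in the cone that they span. Taking
  integer parts of the coefficients, as in Gordan's lemma, writes each element of \<open>E\<close> as an
  \<open>\<nat>\<close>-combination of the \<open>\<alpha>\<^sub>i\<close> plus a remainder from a finite set. For a fixed remainder, the
  coefficient vectors that land in \<open>E\<close> form an upward closed subset of \<open>\<nat>\<^sup>s\<close>, as
  \<open>\<alpha>\<^sub>i \<in> E\<close>; by Dickson's lemma each of them lies above one of finitely many. The corresponding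
  elements of \<open>E\<close>, together with the \<open>\<alpha>\<^sub>i\<close>, generate \<open>E\<close> (\<open>finitely_generated_of_subset_cone\<close>).
\<close>

section \<open>Submonoids between generators and their cone\<close>

text \<open>Dickson's lemma. Fix \<open>x\<^sub>0 \<in> X\<close>: an element not above \<open>x\<^sub>0\<close> agrees with some \<open>k < x\<^sub>0 i\<close> in
  some coordinate \<open>i\<close>, and each of these finitely many slices of \<open>X\<close> involves one coordinate
  less.\<close>

lemma dickson:
  fixes X :: "('i \<Rightarrow> nat) set"
  assumes "finite I"
  shows "\<exists>Y\<subseteq>X. finite Y \<and> (\<forall>x\<in>X. \<exists>y\<in>Y. \<forall>i\<in>I. y i \<le> x i)"
  using assms
proof (induction I arbitrary: X rule: finite_psubset_induct)
  case (psubset I)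
  show ?case
  proof (cases "X = {}")
    case False
    then obtain x0 where x0: "x0 \<in> X" by blast
    define slice where "slice = (\<lambda>(i, k). {x \<in> X. x i = k})"
    define K where "K = (SIGMA i:I. {..<x0 i})"
    have "\<exists>Y\<subseteq>slice p. finite Y \<and> (\<forall>x\<in>slice p. \<exists>y\<in>Y. \<forall>i\<in>I - {fst p}. y i \<le> x i)"
      if "p \<in> K" for p
    proof (rule psubset.IH)
      have "fst p \<in> I" using that by (auto simp: K_def)
      then show "I - {fst p} \<subset> I" by blast
    qed
    then have "\<forall>p\<in>K. \<exists>Y\<subseteq>slice p. finite Y \<and>
        (\<forall>x\<in>slice p. \<exists>y\<in>Y. \<forall>i\<in>I - {fst p}. y i \<le> x i)" ..
    from bchoice[OF this] obtain Y where Y0: "\<forall>p\<in>K. Y p \<subseteq> slice p \<and> finite (Y p) \<and>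
        (\<forall>x\<in>slice p. \<exists>y\<in>Y p. \<forall>i\<in>I - {fst p}. y i \<le> x i)" ..
    have Y: "Y p \<subseteq> slice p" "finite (Y p)"
      "\<And>x. x \<in> slice p \<Longrightarrow> \<exists>y\<in>Y p. \<forall>i\<in>I - {fst p}. y i \<le> x i" if "p \<in> K" for p
      using bspec[OF Y0 that] by auto
    have "finite K" using psubset.hyps by (simp add: K_def)
    moreover have "\<exists>y\<in>insert x0 (\<Union>p\<in>K. Y p). \<forall>i\<in>I. y i \<le> x i" if x: "x \<in> X" for x
    proof (cases "\<forall>i\<in>I. x0 i \<le> x i")
      case False
      then obtain i where i: "i \<in> I" "x i < x0 i" by auto
      then have p: "(i, x i) \<in> K" "x \<in> slice (i, x i)"
        using x by (auto simp: K_def slice_def)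
      then obtain y where y: "y \<in> Y (i, x i)" "\<forall>j\<in>I - {i}. y j \<le> x j"
        using Y(3) by fastforce
      moreover have "y i = x i" using y Y(1)[OF p(1)] by (auto simp: slice_def)
      ultimately have "\<forall>j\<in>I. y j \<le> x j" by (metis Diff_iff order_refl singletonD)
      then show ?thesis using y p by blast
    qed auto
    moreover have "insert x0 (\<Union>p\<in>K. Y p) \<subseteq> X"
      using x0 Y(1) by (fastforce simp: slice_def)
    ultimately show ?thesis
      using Y(2) by (intro exI[of _ "insert x0 (\<Union>p\<in>K. Y p)"]) auto
  qed auto
qed

lemma submonoid_sum:
  assumes "submonoid H" "\<And>i. i \<in> I \<Longrightarrow> h i \<in> H"
  shows "sum h I \<in> H"
  using assms(2)
  by (induction I rule: infinite_finite_induct) (use assms(1) in \<open>auto simp: submonoid_def\<close>)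

lemma submonoid_scale:
  fixes x :: "nat ^ 'n::finite"
  assumes "submonoid H" "x \<in> H"
  shows "k *s x \<in> H"
proof -
  have "k *s x = (\<Sum>i<k. x)" by (simp add: vec_eq_iff of_nat_index)
  also have "\<dots> \<in> H" using assms by (intro submonoid_sum)
  finally show ?thesis .
qed

lemma submonoid_hull: "submonoid (submonoid hull G)"
  unfolding hull_def by (auto simp: submonoid_def)

lemma real_vec_add: "real_vec (\<alpha> + \<beta>) = real_vec \<alpha> + real_vec \<beta>"
  by (simp add: real_vec_def vec_eq_iff)

lemma real_vec_zero: "real_vec 0 = 0"
  by (simp add: real_vec_def vec_eq_iff)

text \<open>The step behind Gordan's lemma: subtracting the integer parts of the coefficients leaves a
  lattice point whose coefficients are less than \<open>1\<close>, so that it is bounded by \<open>\<Sum>\<^sub>i \<alpha>\<^sub>i\<close>.\<close>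

lemma cone_lattice_point_decomposition:
  fixes \<alpha> :: "'i \<Rightarrow> nat ^ 'n::finite"
  assumes \<gamma>: "real_vec \<gamma> = (\<Sum>i\<in>I. l i *\<^sub>R real_vec (\<alpha> i))" and l: "\<forall>i\<in>I. l i \<ge> 0"
  shows "\<exists>m \<beta>. \<gamma> = (\<Sum>i\<in>I. m i *s \<alpha> i) + \<beta> \<and> (\<forall>j. \<beta> $ j \<le> (\<Sum>i\<in>I. \<alpha> i) $ j)"
proof -
  define m where "m i = nat \<lfloor>l i\<rfloor>" for i
  have m: "real (m i) \<le> l i" "l i \<le> real (m i) + 1" if "i \<in> I" for i
    using l that unfolding m_def by auto
  define \<mu> where "\<mu> = (\<Sum>i\<in>I. m i *s \<alpha> i)"
  have \<gamma>_nth: "real (\<gamma> $ j) = (\<Sum>i\<in>I. l i * real (\<alpha> i $ j))" for j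
    using arg_cong[OF \<gamma>, of "\<lambda>v. v $ j"] by (simp add: real_vec_def sum_component)
  have \<mu>_nth: "real (\<mu> $ j) = (\<Sum>i\<in>I. real (m i) * real (\<alpha> i $ j))" for j
    by (simp add: \<mu>_def sum_component)
  have le: "\<mu> $ j \<le> \<gamma> $ j" for j
  proof -
    have "real (\<mu> $ j) \<le> real (\<gamma> $ j)"
      unfolding \<gamma>_nth \<mu>_nth by (intro sum_mono mult_right_mono m) auto
    then show ?thesis by simp
  qed
  have bound: "\<gamma> $ j \<le> \<mu> $ j + (\<Sum>i\<in>I. \<alpha> i) $ j" for j
  proof -
    have "real (\<gamma> $ j) \<le> (\<Sum>i\<in>I. (real (m i) + 1) * real (\<alpha> i $ j))"
      unfolding \<gamma>_nth by (intro sum_mono mult_right_mono m) auto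
    also have "\<dots> = real (\<mu> $ j + (\<Sum>i\<in>I. \<alpha> i) $ j)"
      by (simp add: \<mu>_nth distrib_right sum.distrib sum_component)
    finally show ?thesis by linarith
  qed
  have "\<gamma> = \<mu> + (\<chi> j. \<gamma> $ j - \<mu> $ j)" using le by (simp add: vec_eq_iff)
  then show ?thesis
    using bound unfolding \<mu>_def
    by (intro exI[of _ m] exI[of _ "\<chi> j. \<gamma> $ j - (\<Sum>i\<in>I. m i *s \<alpha> i) $ j"])
      (auto simp: le_diff_conv add.commute)
qed

text \<open>In algebraic terms, the lattice points of the cone form a finitely generated module over the
  monoid generated by the \<open>\<alpha> i\<close> (Gordan), and such a module is noetherian (Dickson).\<close>

lemma finitely_generated_of_subset_cone:
  fixes \<alpha> :: "'i \<Rightarrow> nat ^ 'n::finite" and E :: "(nat ^ 'n) set"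
  assumes "finite I" and E: "submonoid E" and \<alpha>: "\<And>i. i \<in> I \<Longrightarrow> \<alpha> i \<in> E"
    and cone: "real_vec ` E \<subseteq> {\<Sum>i\<in>I. l i *\<^sub>R real_vec (\<alpha> i) | l. \<forall>i\<in>I. l i \<ge> 0}"
  shows "finitely_generated E"
proof -
  define comb where "comb m = (\<Sum>i\<in>I. m i *s \<alpha> i)" for m
  define B where "B = {\<beta> :: nat ^ 'n. \<forall>j. \<beta> $ j \<le> (\<Sum>i\<in>I. \<alpha> i) $ j}"
  have "\<exists>Y\<subseteq>{m. comb m + \<beta> \<in> E}. finite Y \<and>
      (\<forall>x\<in>{m. comb m + \<beta> \<in> E}. \<exists>y\<in>Y. \<forall>i\<in>I. y i \<le> x i)" for \<beta>
    by (rule dickson[OF assms(1)])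
  then obtain Y where Y: "\<And>\<beta>. Y \<beta> \<subseteq> {m. comb m + \<beta> \<in> E}" "\<And>\<beta>. finite (Y \<beta>)"
    "\<And>\<beta> x. comb x + \<beta> \<in> E \<Longrightarrow> \<exists>y\<in>Y \<beta>. \<forall>i\<in>I. y i \<le> x i"
    by (metis mem_Collect_eq)
  define G where "G = \<alpha> ` I \<union> (\<Union>\<beta>\<in>B. (\<lambda>m. comb m + \<beta>) ` Y \<beta>)"
  have "finite B" unfolding B_def by (rule finite_vec_le)
  then have "finite G" using Y(2) assms(1) by (auto simp: G_def)
  have "G \<subseteq> E" using Y(1) \<alpha> by (auto simp: G_def)
  then have "submonoid hull G \<subseteq> E" using E by (rule hull_minimal)
  moreover have "\<gamma> \<in> submonoid hull G" if \<gamma>: "\<gamma> \<in> E" for \<gamma>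
  proof -
    obtain l where "real_vec \<gamma> = (\<Sum>i\<in>I. l i *\<^sub>R real_vec (\<alpha> i))" "\<forall>i\<in>I. l i \<ge> 0"
      using cone \<gamma> by blast
    from cone_lattice_point_decomposition[OF this]
    obtain m \<beta> where m: "\<gamma> = comb m + \<beta>" and \<beta>: "\<beta> \<in> B"
      unfolding comb_def B_def by blast
    then obtain y where y: "y \<in> Y \<beta>" "\<forall>i\<in>I. y i \<le> m i" using Y(3) \<gamma> by blast
    \<comment> \<open>\<open>comb y + \<beta>\<close> is one of the chosen generators; the excess \<open>m - y\<close> is made up by the
        \<open>\<alpha> i\<close>.\<close>
    have "comb m = comb (\<lambda>i. m i - y i) + comb y"
      using y(2) by (auto simp: comb_def vec_eq_iff sum_component simp flip: sum.distrib distrib_right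
          intro!: sum.cong)
    then have "\<gamma> = comb (\<lambda>i. m i - y i) + (comb y + \<beta>)" using m by (simp add: add.assoc)
    moreover have "comb (\<lambda>i. m i - y i) \<in> submonoid hull G"
      unfolding comb_def
      by (intro submonoid_sum submonoid_hull submonoid_scale hull_inc) (auto simp: G_def)
    moreover have "comb y + \<beta> \<in> submonoid hull G"
      using y(1) \<beta> by (intro hull_inc) (auto simp: G_def)
    ultimately show ?thesis using submonoid_hull[of G] by (simp add: submonoid_def)
  qed
  ultimately show ?thesis
    using \<open>finite G\<close> unfolding finitely_generated_def by blast
qed

section \<open>Closed subalgebras and supports\<close>

lemma coeff_zero [simp]: "coeff 0 \<gamma> = 0"
  by (simp add: zero_mfps_def)

lemma coeff_add [simp]: "coeff (f + g) \<gamma> = coeff f \<gamma> + coeff g \<gamma>"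
  by (simp add: plus_mfps_def)

lemma coeff_mult: "coeff (f * g) \<gamma> = (\<Sum>(\<alpha>, \<beta>)\<in>splittings \<gamma>. coeff f \<alpha> * coeff g \<beta>)"
  by (simp add: times_mfps_def)

lemma coeff_monom: "coeff (monom c \<alpha>) \<beta> = (if \<beta> = \<alpha> then c else 0)"
  by (simp add: monom_def)

lemma Supp_mult:
  assumes "\<gamma> \<in> Supp (f * g)"
  obtains \<alpha> \<beta> where "\<alpha> \<in> Supp f" "\<beta> \<in> Supp g" "\<gamma> = \<alpha> + \<beta>"
proof -
  have "(\<Sum>(\<alpha>, \<beta>)\<in>splittings \<gamma>. coeff f \<alpha> * coeff g \<beta>) \<noteq> 0"
    using assms by (simp add: Supp_def coeff_mult)
  then obtain p where p: "p \<in> splittings \<gamma>"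
    and "(case p of (\<alpha>, \<beta>) \<Rightarrow> coeff f \<alpha> * coeff g \<beta>) \<noteq> 0"
    by (rule sum.not_neutral_contains_not_neutral)
  then have "coeff f (fst p) \<noteq> 0" "coeff g (snd p) \<noteq> 0" by (auto simp: case_prod_beta)
  then show ?thesis using p that[of "fst p" "snd p"] by (auto simp: splittings_def Supp_def)
qed

lemma Supp_add: "Supp (f + g) \<subseteq> Supp f \<union> Supp g"
  by (auto simp: Supp_def)

text \<open>Hence series that are close in the adic topology agree in low degree. The series of order at
  least \<open>N\<close> form an ideal, and orders add up under multiplication.\<close>

lemma total_degree_ge_of_var_ideal_pow:
  fixes h :: "('a::comm_ring_1, 'n::finite) mfps"
  assumes "h \<in> var_ideal_pow N" "\<gamma> \<in> Supp h"
  shows "N \<le> (\<Sum>j\<in>UNIV. \<gamma> $ j)"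
proof -
  define D where "D N = {h :: ('a, 'n) mfps. \<forall>\<gamma>\<in>Supp h. N \<le> (\<Sum>j\<in>UNIV. \<gamma> $ j)}" for N
  have D_mult: "f * g \<in> D (M + N)" if "f \<in> D M" "g \<in> D N" for f g M N
    unfolding D_def
  proof (clarify)
    fix \<gamma> assume "\<gamma> \<in> Supp (f * g)"
    then obtain \<alpha> \<beta> where "\<alpha> \<in> Supp f" "\<beta> \<in> Supp g" "\<gamma> = \<alpha> + \<beta>" by (rule Supp_mult)
    then show "M + N \<le> (\<Sum>j\<in>UNIV. \<gamma> $ j)"
      using that by (auto simp: D_def sum.distrib intro: add_mono)
  qed
  have D_ideal: "module.subspace (*) (D N)" for N
  proof (rule module.subspaceI[OF module_mfps])
    show "c * x \<in> D N" if "x \<in> D N" for c x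
      using D_mult[of c 0 x N] that by (simp add: D_def)
    show "x + y \<in> D N" if "x \<in> D N" "y \<in> D N" for x y
      using that Supp_add[of x y] by (fastforce simp: D_def)
  qed (simp add: D_def Supp_def)
  have var: "var_ideal \<subseteq> D 1"
    unfolding var_ideal_def
  proof (rule module.span_minimal[OF module_mfps _ D_ideal])
    have "1 \<le> (\<Sum>j\<in>UNIV. \<gamma> $ j)" if "\<gamma> = axis i 1" for \<gamma> :: "nat ^ 'n" and i
      using member_le_sum[of i UNIV "\<lambda>j. \<gamma> $ j"] that by (simp add: axis_def)
    then show "range var \<subseteq> D 1"
      by (auto simp: D_def var_def Supp_def coeff_monom simp del: One_nat_def split: if_splits)
  qed
  have "var_ideal_pow N \<subseteq> D N"
  proof (induction N)
    case (Suc N)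
    show ?case unfolding var_ideal_pow.simps
      by (rule module.span_minimal[OF module_mfps _ D_ideal])
        (use var Suc D_mult[of _ 1 _ N] in auto)
  qed (auto simp: D_def)
  then show ?thesis using assms by (auto simp: D_def)
qed

lemma mem_closure_mfps_iff:
  fixes g :: "('a::comm_ring_1, 'n::finite) mfps"
  shows "g \<in> closure S \<longleftrightarrow> (\<forall>N. \<exists>g'\<in>S. g' - g \<in> var_ideal_pow N)" (is "_ \<longleftrightarrow> ?R")
proof
  assume g: "g \<in> closure S"
  show ?R
  proof
    fix N
    define U where "U = {g + h | h. h \<in> var_ideal_pow N}"
    note add = module.subspace_add[OF module_mfps subspace_var_ideal_pow]
    have "open U"
      unfolding open_mfps_def
    proof
      fix x assume "x \<in> U"
      then obtain h where h: "x = g + h" "h \<in> var_ideal_pow N" by (auto simp: U_def)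
      have "{x + k | k. k \<in> var_ideal_pow N} \<subseteq> U"
        using h by (auto simp: U_def add.assoc intro: add)
      then show "\<exists>N. {x + k | k. k \<in> var_ideal_pow N} \<subseteq> U" by blast
    qed
    moreover have "g \<in> U"
      using module.subspace_0[OF module_mfps subspace_var_ideal_pow] by (force simp: U_def)
    ultimately have "S \<inter> U \<noteq> {}" using g open_Int_closure_eq_empty[of U S] by blast
    then obtain h where "g + h \<in> S" "h \<in> var_ideal_pow N" by (auto simp: U_def)
    then show "\<exists>g'\<in>S. g' - g \<in> var_ideal_pow N" by (intro bexI[of _ "g + h"]) auto
  qed
next
  assume R: ?R
  have "S \<inter> U \<noteq> {}" if U: "open U" "g \<in> U" for U
  proof -
    obtain N where N: "{g + h | h. h \<in> var_ideal_pow N} \<subseteq> U"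
      using U unfolding open_mfps_def by blast
    obtain g' where "g' \<in> S" "g' - g \<in> var_ideal_pow N" using R by blast
    moreover from this have "g + (g' - g) \<in> U" using N by blast
    ultimately show ?thesis by auto
  qed
  then show "g \<in> closure S"
    by (metis Compl_iff closed_closure closure_subset open_Compl disjoint_iff subsetD)
qed

lemma closed_Supp_subset:
  "closed {g :: ('a::comm_ring_1, 'n::finite) mfps. Supp g \<subseteq> P}"
proof -
  have "g \<in> {g. Supp g \<subseteq> P}" if g: "g \<in> closure {g. Supp g \<subseteq> P}" for g :: "('a, 'n) mfps"
  proof clarify
    fix \<gamma> assume \<gamma>: "\<gamma> \<in> Supp g"
    obtain g' where g': "Supp g' \<subseteq> P" "g' - g \<in> var_ideal_pow (Suc (\<Sum>j\<in>UNIV. \<gamma> $ j))"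
      using g unfolding mem_closure_mfps_iff by blast
    have "\<gamma> \<notin> Supp (g' - g)"
      using total_degree_ge_of_var_ideal_pow[OF g'(2), of \<gamma>] by auto
    then have "\<gamma> \<in> Supp g'" using \<gamma> by (auto simp: Supp_def minus_mfps_def)
    then show "\<gamma> \<in> P" using g' by blast
  qed
  then show ?thesis by (metis closure_subset closure_closed closed_closure subsetI subset_antisym)
qed

lemma subalgebra_hull: "subalgebra (subalgebra hull S)"
  unfolding hull_def by (auto simp: subalgebra_def)

text \<open>Addition and multiplication are continuous, since the powers of the ideal are themselves
  ideals.\<close>

lemma subalgebra_closure:
  fixes S :: "('a::comm_ring_1, 'n::finite) mfps set"
  assumes "subalgebra S"
  shows "subalgebra (closure S)"
proof -
  note add = module.subspace_add[OF module_mfps subspace_var_ideal_pow]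
  note scale = module.subspace_scale[OF module_mfps subspace_var_ideal_pow]
  have "f + g \<in> closure S \<and> f * g \<in> closure S" if fg: "f \<in> closure S" "g \<in> closure S" for f g
    unfolding mem_closure_mfps_iff
  proof (intro conjI allI)
    fix N
    obtain f' g' where f': "f' \<in> S" "f' - f \<in> var_ideal_pow N"
      and g': "g' \<in> S" "g' - g \<in> var_ideal_pow N"
      using fg unfolding mem_closure_mfps_iff by blast
    have "(f' + g') - (f + g) = (f' - f) + (g' - g)" by simp
    then have "(f' + g') - (f + g) \<in> var_ideal_pow N" using add f' g' by metis
    then show "\<exists>x\<in>S. x - (f + g) \<in> var_ideal_pow N"
      using assms f' g' unfolding subalgebra_def by blast
    have "f' * g' - f * g = g' * (f' - f) + f * (g' - g)" by (simp add: algebra_simps)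
    then have "f' * g' - f * g \<in> var_ideal_pow N" using add scale f' g' by metis
    then show "\<exists>x\<in>S. x - f * g \<in> var_ideal_pow N"
      using assms f' g' unfolding subalgebra_def by blast
  qed
  then show ?thesis
    using assms closure_subset[of S] by (auto simp: subalgebra_def)
qed

lemma subalgebra_closed_algebra_gen: "subalgebra (closed_algebra_gen S)"
  unfolding closed_algebra_gen_def by (intro subalgebra_closure subalgebra_hull)

lemma closed_algebra_gen_superset: "S \<subseteq> closed_algebra_gen S"
  unfolding closed_algebra_gen_def using hull_subset closure_subset by (rule subset_trans)

lemma Supp_closed_algebra_gen:
  fixes S :: "('a::comm_ring_1, 'n::finite) mfps set"
  assumes P: "submonoid P" and S: "\<And>g. g \<in> S \<Longrightarrow> Supp g \<subseteq> P"
    and g: "g \<in> closed_algebra_gen S"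
  shows "Supp g \<subseteq> P"
proof -
  let ?B = "{g :: ('a, 'n) mfps. Supp g \<subseteq> P}"
  have "subalgebra ?B"
    unfolding subalgebra_def
  proof (intro conjI allI ballI)
    fix c show "monom c 0 \<in> ?B" using P by (auto simp: Supp_def coeff_monom submonoid_def)
  next
    fix x y assume xy: "x \<in> ?B" "y \<in> ?B"
    show "x + y \<in> ?B" using xy Supp_add[of x y] by blast
    show "x * y \<in> ?B" using xy P by (auto simp: submonoid_def elim!: Supp_mult)
  qed
  then have "subalgebra hull S \<subseteq> ?B" using S by (intro hull_minimal) auto
  then have "closure (subalgebra hull S) \<subseteq> ?B"
    using closed_Supp_subset by (rule closure_minimal)
  then show ?thesis using g unfolding closed_algebra_gen_def by blast
qed

section \<open>Exponents of products\<close>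

lemma linear_order_has_max:
  assumes "linear_order_on UNIV r" "finite S" "S \<noteq> {}"
  shows "\<exists>m\<in>S. \<forall>x\<in>S. (x, m) \<in> r"
  using assms(2,3)
proof (induction rule: finite_ne_induct)
  case (singleton x)
  then show ?case using assms(1) by (auto simp: order_on_defs refl_on_def)
next
  case (insert x F)
  then obtain m where m: "m \<in> F" "\<forall>y\<in>F. (y, m) \<in> r" by blast
  have "(x, x) \<in> r" "(x, m) \<in> r \<or> (m, x) \<in> r"
    using assms(1) unfolding order_on_defs refl_on_def total_on_def by (auto, metis)
  moreover have "trans r" using assms(1) by (simp add: order_on_defs)
  ultimately show ?case using m by (metis insert_iff transD)
qed

lemma monomial_order_linear: "monomial_order r \<Longrightarrow> linear_order_on UNIV r"
  by (simp add: monomial_order_def well_order_on_def)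

lemma monomial_order_mono:
  "monomial_order r \<Longrightarrow> (\<alpha>, \<beta>) \<in> r \<Longrightarrow> (\<alpha> + \<gamma>, \<beta> + \<gamma>) \<in> r"
  by (simp add: monomial_order_def)

lemma weight_add: "a \<bullet> real_vec (\<alpha> + \<beta>) = a \<bullet> real_vec \<alpha> + a \<bullet> real_vec \<beta>"
  by (simp add: real_vec_add inner_add_right)

lemma finite_weight_le:
  fixes a :: "real ^ 'n::finite"
  assumes "\<forall>j. a $ j > 0"
  shows "finite {\<alpha> :: nat ^ 'n. a \<bullet> real_vec \<alpha> \<le> v}"
proof (rule finite_subset)
  show "{\<alpha> :: nat ^ 'n. a \<bullet> real_vec \<alpha> \<le> v} \<subseteq> {\<alpha>. \<forall>j. \<alpha> $ j \<le> (\<chi> j. nat \<lceil>v / a $ j\<rceil>) $ j}"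
  proof clarify
    fix \<alpha> :: "nat ^ 'n" and j
    assume v: "a \<bullet> real_vec \<alpha> \<le> v"
    have "a $ j * real (\<alpha> $ j) \<le> (\<Sum>j\<in>UNIV. a $ j * real (\<alpha> $ j))"
      using assms by (intro member_le_sum) (auto simp: less_imp_le)
    also have "\<dots> = a \<bullet> real_vec \<alpha>" by (simp add: inner_vec_def real_vec_def)
    finally have "real (\<alpha> $ j) \<le> v / a $ j"
      using assms v by (simp add: field_simps)
    then show "\<alpha> $ j \<le> (\<chi> j. nat \<lceil>v / a $ j\<rceil>) $ j" by (simp add: le_nat_iff) linarith
  qed
qed (rule finite_vec_le)

text \<open>The exponent is the first element of the support for one total order: smaller weight first,
  ties broken by the larger monomial. This order is again compatible with sums, which makes
  products easy to treat.\<close>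

definition leads ::
  "(nat ^ 'n::finite) rel \<Rightarrow> real ^ 'n \<Rightarrow> ('a::zero, 'n) mfps \<Rightarrow> nat ^ 'n \<Rightarrow> bool" where
  "leads r a g \<alpha> \<longleftrightarrow> \<alpha> \<in> Supp g \<and> (\<forall>\<beta>\<in>Supp g.
     a \<bullet> real_vec \<alpha> < a \<bullet> real_vec \<beta> \<or> a \<bullet> real_vec \<alpha> = a \<bullet> real_vec \<beta> \<and> (\<beta>, \<alpha>) \<in> r)"

lemma leads_unique:
  assumes "linear_order_on UNIV r" "leads r a g \<alpha>" "leads r a g \<beta>"
  shows "\<alpha> = \<beta>"
  using assms unfolding leads_def order_on_defs antisym_def by (metis less_asym less_irrefl)

lemma expo_eq_of_leads:
  assumes "linear_order_on UNIV r" "leads r a g \<alpha>"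
  shows "expo r g a = \<alpha>"
proof -
  have val: "val g a = a \<bullet> real_vec \<alpha>"
    unfolding val_def using assms(2) by (intro Least_equality) (auto simp: leads_def)
  have Supp: "Supp (initial_form g a) = {\<beta> \<in> Supp g. a \<bullet> real_vec \<beta> = a \<bullet> real_vec \<alpha>}"
    by (auto simp: Supp_def initial_form_def val)
  have "antisym r" using assms(1) by (simp add: order_on_defs)
  then show ?thesis
    unfolding expo_def Supp using assms(2)
    by (intro the_equality) (auto simp: leads_def antisym_def)
qed

lemma leads_expo:
  fixes g :: "('a::comm_ring_1, 'n::finite) mfps"
  assumes r: "linear_order_on UNIV r" and a: "\<forall>j. a $ j > 0" and "g \<noteq> 0"
  shows "leads r a g (expo r g a)"
proof -
  obtain \<gamma> where \<gamma>: "\<gamma> \<in> Supp g" using \<open>g \<noteq> 0\<close> by (force simp: Supp_def intro: mfps_eqI)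
  \<comment> \<open>The weight attains its minimum, as only finitely many exponents weigh no more than \<open>\<gamma>\<close>.\<close>
  define T where "T = {\<beta> \<in> Supp g. a \<bullet> real_vec \<beta> \<le> a \<bullet> real_vec \<gamma>}"
  have T: "finite T" "T \<noteq> {}"
    using finite_weight_le[OF a, of "a \<bullet> real_vec \<gamma>"] \<gamma> by (auto simp: T_def)
  define v where "v = Min ((\<lambda>\<beta>. a \<bullet> real_vec \<beta>) ` T)"
  have v_le: "v \<le> a \<bullet> real_vec \<beta>" if "\<beta> \<in> Supp g" for \<beta>
  proof (cases "\<beta> \<in> T")
    case False
    have "v \<le> a \<bullet> real_vec \<gamma>" using T \<gamma> by (auto simp: v_def T_def)
    then show ?thesis using False that by (auto simp: T_def)
  qed (use T in \<open>auto simp: v_def\<close>)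
  have "v \<in> (\<lambda>\<beta>. a \<bullet> real_vec \<beta>) ` T" unfolding v_def using T by (intro Min_in) auto
  then have ne: "{\<beta> \<in> T. a \<bullet> real_vec \<beta> = v} \<noteq> {}" by auto
  obtain m where m: "m \<in> T" "a \<bullet> real_vec m = v"
    "\<And>\<beta>. \<beta> \<in> T \<Longrightarrow> a \<bullet> real_vec \<beta> = v \<Longrightarrow> (\<beta>, m) \<in> r"
    using linear_order_has_max[OF r _ ne] T by auto
  have "leads r a g m"
    unfolding leads_def
  proof (intro conjI ballI)
    show "m \<in> Supp g" using m by (simp add: T_def)
    fix \<beta> assume \<beta>: "\<beta> \<in> Supp g"
    show "a \<bullet> real_vec m < a \<bullet> real_vec \<beta> \<or>
        a \<bullet> real_vec m = a \<bullet> real_vec \<beta> \<and> (\<beta>, m) \<in> r"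
    proof (cases "a \<bullet> real_vec \<beta> = v")
      case True
      then have "\<beta> \<in> T" using \<beta> m by (auto simp: T_def)
      then show ?thesis using True m by auto
    qed (use v_le[OF \<beta>] m in auto)
  qed
  then show ?thesis using expo_eq_of_leads[OF r] by metis
qed

text \<open>The coefficient at \<open>\<alpha> + \<beta>\<close> does not cancel: \<open>(\<alpha>, \<beta>)\<close> is the only pair of exponents
  with this sum, since moving either factor later in the order moves the sum strictly later.\<close>

lemma leads_mult:
  fixes f g :: "('a::idom, 'n::finite) mfps"
  assumes r: "monomial_order r" and f: "leads r a f \<alpha>" and g: "leads r a g \<beta>"
  shows "leads r a (f * g) (\<alpha> + \<beta>)"
proof -
  have lin: "antisym r" "trans r"
    using monomial_order_linear[OF r] by (auto simp: order_on_defs)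
  \<comment> \<open>Replace the summands one at a time, passing through \<open>\<delta> + \<beta>\<close>; keeping this intermediate
      sum in the conclusion lets antisymmetry separate the summands below.\<close>
  have le: "a \<bullet> real_vec (\<alpha> + \<beta>) < a \<bullet> real_vec (\<delta> + \<epsilon>) \<or>
      a \<bullet> real_vec (\<alpha> + \<beta>) = a \<bullet> real_vec (\<delta> + \<epsilon>) \<and>
        (\<delta> + \<epsilon>, \<delta> + \<beta>) \<in> r \<and> (\<delta> + \<beta>, \<alpha> + \<beta>) \<in> r"
    if \<delta>: "\<delta> \<in> Supp f" and \<epsilon>: "\<epsilon> \<in> Supp g" for \<delta> \<epsilon>
  proof -
    have "a \<bullet> real_vec \<alpha> < a \<bullet> real_vec \<delta> \<or>
        a \<bullet> real_vec \<alpha> = a \<bullet> real_vec \<delta> \<and> (\<delta> + \<beta>, \<alpha> + \<beta>) \<in> r"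
      using f \<delta> monomial_order_mono[OF r, of \<delta> \<alpha> \<beta>] by (auto simp: leads_def)
    moreover have "a \<bullet> real_vec \<beta> < a \<bullet> real_vec \<epsilon> \<or>
        a \<bullet> real_vec \<beta> = a \<bullet> real_vec \<epsilon> \<and> (\<delta> + \<epsilon>, \<delta> + \<beta>) \<in> r"
      using g \<epsilon> monomial_order_mono[OF r, of \<epsilon> \<beta> \<delta>] by (auto simp: leads_def add.commute)
    ultimately show ?thesis unfolding weight_add by linarith
  qed
  have unique: "\<delta> = \<alpha> \<and> \<epsilon> = \<beta>"
    if "\<delta> \<in> Supp f" "\<epsilon> \<in> Supp g" "\<delta> + \<epsilon> = \<alpha> + \<beta>" for \<delta> \<epsilon>
  proof -
    have "(\<alpha> + \<beta>, \<delta> + \<beta>) \<in> r" "(\<delta> + \<beta>, \<alpha> + \<beta>) \<in> r"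
      using le[OF that(1,2)] that(3) by auto
    then have "\<delta> + \<beta> = \<alpha> + \<beta>" using lin(1) by (blast dest: antisymD)
    then show ?thesis using that(3) by auto
  qed
  have "coeff (f * g) (\<alpha> + \<beta>) = (\<Sum>(\<delta>, \<epsilon>)\<in>{(\<alpha>, \<beta>)}. coeff f \<delta> * coeff g \<epsilon>)"
    unfolding coeff_mult
    by (rule sum.mono_neutral_right[OF finite_splittings]) (use unique in \<open>auto simp: splittings_def Supp_def\<close>)
  then have "\<alpha> + \<beta> \<in> Supp (f * g)"
    using f g by (simp add: leads_def Supp_def)
  moreover have "a \<bullet> real_vec (\<alpha> + \<beta>) < a \<bullet> real_vec \<gamma> \<or>
      a \<bullet> real_vec (\<alpha> + \<beta>) = a \<bullet> real_vec \<gamma> \<and> (\<gamma>, \<alpha> + \<beta>) \<in> r"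
    if "\<gamma> \<in> Supp (f * g)" for \<gamma>
    using that
  proof (rule Supp_mult)
    fix \<delta> \<epsilon> assume "\<delta> \<in> Supp f" "\<epsilon> \<in> Supp g" "\<gamma> = \<delta> + \<epsilon>"
    then show ?thesis using le[of \<delta> \<epsilon>] lin(2) by (auto dest: transD)
  qed
  ultimately show ?thesis by (auto simp: leads_def)
qed

lemma submonoid_expo_set:
  fixes A :: "('a::idom, 'n::finite) mfps set"
  assumes r: "monomial_order r" and a: "\<forall>j. a $ j > 0" and A: "subalgebra A"
  shows "submonoid (expo_set r A a)"
  unfolding submonoid_def
proof (intro conjI ballI)
  note lin = monomial_order_linear[OF r]
  let ?one = "monom 1 0 :: ('a, 'n) mfps"
  have "leads r a ?one 0"
    using lin by (auto simp: leads_def Supp_def coeff_monom order_on_defs refl_on_def)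
  then have "expo r ?one a = 0" by (rule expo_eq_of_leads[OF lin])
  moreover have "?one \<in> A" using A by (simp add: subalgebra_def)
  moreover have "?one \<noteq> 0" using coeff_monom[of "1::'a" 0 0] by (metis coeff_zero zero_neq_one)
  ultimately show "0 \<in> expo_set r A a" unfolding expo_set_def by fastforce
next
  note lin = monomial_order_linear[OF r]
  fix \<alpha> \<beta> assume "\<alpha> \<in> expo_set r A a" "\<beta> \<in> expo_set r A a"
  then obtain f g where f: "\<alpha> = expo r f a" "f \<in> A" "f \<noteq> 0"
    and g: "\<beta> = expo r g a" "g \<in> A" "g \<noteq> 0"
    by (auto simp: expo_set_def)
  have "leads r a (f * g) (\<alpha> + \<beta>)"
    unfolding f g by (intro leads_mult r leads_expo lin a f g)
  then have "expo r (f * g) a = \<alpha> + \<beta>" "f * g \<noteq> 0"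
    using expo_eq_of_leads[OF lin] by (auto simp: leads_def Supp_def)
  moreover have "f * g \<in> A" using A f g by (simp add: subalgebra_def)
  ultimately show "\<alpha> + \<beta> \<in> expo_set r A a" unfolding expo_set_def by force
qed

text \<open>A nonzero monomial determines its exponent; since the leading coefficient is nonzero, so does
  the leading monomial.\<close>

lemma expo_eq_of_lead_monom:
  fixes g :: "('a::comm_ring_1, 'n::finite) mfps"
  assumes "linear_order_on UNIV r" "\<forall>j. a $ j > 0" "g \<noteq> 0"
    and "lead_monom r g a = monom c \<alpha>"
  shows "expo r g a = \<alpha>"
proof -
  have "coeff (lead_monom r g a) (expo r g a) \<noteq> 0"
    using leads_expo[OF assms(1-3)] by (simp add: lead_monom_def coeff_monom leads_def Supp_def)
  then show ?thesis by (simp add: assms(4) coeff_monom split: if_splits)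
qed

section \<open>Exponents of the closed algebra\<close>

theorem lemma20:
  fixes r :: "(nat ^ 'n::finite) rel"
    and a :: "real ^ 'n"
    and s :: nat
    and f :: "nat \<Rightarrow> ('k::field, 'n) mfps"
    and \<alpha> :: "nat \<Rightarrow> nat ^ 'n"
    and A :: "('k, 'n) mfps set"
    and C :: "(real ^ 'n) set"
  assumes "monomial_order r"
    and "\<forall>j. a $ j > 0"
    and "\<forall>i\<in>{1..s}. f i \<noteq> 0"
    and "A = closed_algebra_gen (f ` {1..s})"
    and "\<forall>i\<in>{1..s}. lead_monom r (f i) a = monom (coeff (f i) (\<alpha> i)) (\<alpha> i)"
    and "C = {\<Sum>i=1..s. l i *\<^sub>R real_vec (\<alpha> i) | l. \<forall>i\<in>{1..s}. l i \<ge> 0}"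
    and "\<forall>i\<in>{1..s}. real_vec ` Supp (f i) \<subseteq> C"
  shows "real_vec ` expo_set r A a \<subseteq> C \<and> finitely_generated (expo_set r A a)"
proof
  note lin = monomial_order_linear[OF assms(1)]
  have C_add: "x + y \<in> C" if xy: "x \<in> C" "y \<in> C" for x y
  proof -
    obtain l k where "x = (\<Sum>i=1..s. l i *\<^sub>R real_vec (\<alpha> i))" "\<forall>i\<in>{1..s}. l i \<ge> 0"
      "y = (\<Sum>i=1..s. k i *\<^sub>R real_vec (\<alpha> i))" "\<forall>i\<in>{1..s}. k i \<ge> 0"
      using xy assms(6) by blast
    then show ?thesis
      unfolding assms(6)
      by (intro CollectI exI[of _ "\<lambda>i. l i + k i"]) (auto simp: scaleR_add_left sum.distrib)
  qed
  have "0 \<in> C" unfolding assms(6) by (intro CollectI exI[of _ "\<lambda>_. 0"]) auto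
  then have P: "submonoid {\<gamma>. real_vec \<gamma> \<in> C}"
    using C_add by (auto simp: submonoid_def real_vec_add real_vec_zero)
  show cone: "real_vec ` expo_set r A a \<subseteq> C"
  proof clarify
    fix \<gamma> assume "\<gamma> \<in> expo_set r A a"
    then obtain g where g: "\<gamma> = expo r g a" "g \<in> A" "g \<noteq> 0" by (auto simp: expo_set_def)
    have "\<gamma> \<in> Supp g" using leads_expo[OF lin assms(2) g(3)] g(1) by (simp add: leads_def)
    moreover have "Supp g \<subseteq> {\<gamma>. real_vec \<gamma> \<in> C}"
      by (rule Supp_closed_algebra_gen[OF P]) (use assms(4,7) g in auto)
    ultimately show "real_vec \<gamma> \<in> C" by blast
  qed
  have A: "subalgebra A" unfolding assms(4) by (rule subalgebra_closed_algebra_gen)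
  have "\<alpha> i \<in> expo_set r A a" if i: "i \<in> {1..s}" for i
  proof -
    have "expo r (f i) a = \<alpha> i" using assms(3,5) i by (intro expo_eq_of_lead_monom lin assms(2)) auto
    moreover have "f i \<in> A" using i closed_algebra_gen_superset assms(4) by blast
    ultimately show ?thesis using assms(3) i unfolding expo_set_def by force
  qed
  then show "finitely_generated (expo_set r A a)"
    using cone unfolding assms(6)
    by (intro finitely_generated_of_subset_cone[of "{1..s}" _ \<alpha>] submonoid_expo_set assms A) auto
qed

end
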